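(* Let $W\in\mathbb{R}^{n\times n}$ be positive definite (i.e. $x^TWx>0$ for all nonzero $x$; $W$ need not be symmetric), with symmetric part $H=\frac12(W+W^T)$ and skew-symmetric part $S=\frac12(W-W^T)$. Write $S=L_s+U_s$ where $L_s$ is the (strictly) lower triangular part and $U_s=-L_s^T$ the upper triangular part of $S$, and assume $L_s\neq 0$. Let $B\in\mathbb{R}^{m\times n}$ with $\operatorname{rank}(B)<m\le n$, let $$A=\begin{pmatrix} W & B^T\\ -B & 0\end{pmatrix},$$ and let $b\in\mathbb{R}^{n+m}$ lie in the range of $A$. For $\omega>0$ let $P=\frac1\omega(I+\omega L_s)(I+\omega U_s)$ and $$M=\begin{pmatrix} P & B^T\\ -B & 0\end{pmatrix}.$$ If $$0<\omega<\frac{-\lambda_{\max}(H)+\sqrt{\lambda_{\max}(H)^2+16\|L_s\|_2^2}}{4\|L_s\|_2^2},$$ then the iteration $x^{(k+1)}=x^{(k)}+M^\dagger(b-Ax^{(k)})$, $k=0,1,2,\dots$, is convergent.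
   Context: $M^\dagger$ is the Moore–Penrose inverse of $M$; $\lambda_{\max}(H)$ is the largest eigenvalue of $H$; $\|\cdot\|_2$ is the spectral norm. The iteration is called convergent if the sequence $x^{(k)}$ converges (to a solution of $Ax=b$) for every initial guess $x^{(0)}$; equivalently, with $T=I-M^\dagger A$, the limit $\lim_{k\to\infty}T^k$ exists. *)

theory Defs
  imports "HOL-Analysis.Analysis"
begin

text \<open>Moore--Penrose inverse: the unique X satisfying the four Penrose equations.\<close>
definition is_mp_inverse :: "real^'m^'n \<Rightarrow> real^'n^'m \<Rightarrow> bool" where
  "is_mp_inverse X M \<longleftrightarrow>
     M ** X ** M = M \<and> X ** M ** X = X \<and>
     transpose (M ** X) = M ** X \<and> transpose (X ** M) = X ** M"

definition mp_inverse :: "real^'n^'m \<Rightarrow> real^'m^'n" where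
  "mp_inverse M = (THE X. is_mp_inverse X M)"

text \<open>Largest eigenvalue of a (symmetric) real matrix.\<close>
definition lambda_max :: "real^'n^'n \<Rightarrow> real" where
  "lambda_max H = Max {l. \<exists>v. v \<noteq> 0 \<and> H *v v = l *\<^sub>R v}"

text \<open>Spectral norm = operator norm induced by the Euclidean norm.\<close>
definition spec_norm :: "real^'n^'m \<Rightarrow> real" where
  "spec_norm L = onorm (\<lambda>x. L *v x)"

text \<open>Strictly lower / strictly upper triangular parts (w.r.t. the order of the index type).\<close>
definition lower_part :: "real^'n::{finite,linorder}^'n::{finite,linorder} \<Rightarrow> real^'n::{finite,linorder}^'n::{finite,linorder}" where
  "lower_part S = (\<chi> i j. if j < i then S $ i $ j else 0)"
definition upper_part :: "real^'n::{finite,linorder}^'n::{finite,linorder} \<Rightarrow> real^'n::{finite,linorder}^'n::{finite,linorder}" where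
  "upper_part S = (\<chi> i j. if i < j then S $ i $ j else 0)"

text \<open>Saddle point block matrix [[X, B^T], [-B, 0]] indexed by 'n + 'm.\<close>
definition saddle :: "real^'n^'n \<Rightarrow> real^'n^'m \<Rightarrow> real^('n + 'm)^('n + 'm)" where
  "saddle X B = (\<chi> i j. case i of
      Inl i' \<Rightarrow> (case j of Inl j' \<Rightarrow> X $ i' $ j' | Inr j' \<Rightarrow> B $ j' $ i')
    | Inr i' \<Rightarrow> (case j of Inl j' \<Rightarrow> - B $ i' $ j' | Inr j' \<Rightarrow> 0))"

text \<open>The iterates x(k+1) = x(k) + M^+ (b - A x(k)).\<close>
primrec iterate :: "real^'k^'k \<Rightarrow> real^'k^'k \<Rightarrow> real^'k \<Rightarrow> real^'k \<Rightarrow> nat \<Rightarrow> real^'k" where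
  "iterate M A b x0 0 = x0"
| "iterate M A b x0 (Suc k) =
     iterate M A b x0 k + mp_inverse M *v (b - A *v iterate M A b x0 k)"

end

theory Submission
  imports Defs
begin

text \<open>
  Write A = saddle W B and M = saddle P B, and fix y with A y = b. As P is positive definite, the
  range of A lies in that of M, so M M^+ acts as the identity on it and the errors e_k = x_k - y
  satisfy M e_(k+1) = (M - A) e_k. In blocks, the first component u_k of e_k satisfies
  B u_(k+1) = 0 and P u_(k+1) + B^T v_(k+1) = (P - W) u_k, and when P - W is symmetric this yields
  the energy identity
    2 (u_k^T P u_k - u_(k+1)^T P u_(k+1))
      = (u_k + u_(k+1))^T W (u_k + u_(k+1)) + (u_k - u_(k+1))^T (2P - W) (u_k - u_(k+1)).
  Hence the energy decays geometrically as soon as W and 2P - W are positive definite. The residuals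
  b - A x_(k+1) = (M - A)(e_k - e_(k+1)) only see the first block, so they are summable, and then so
  are the increments M^+ (b - A x_k): the iterates converge to a solution.

  For the skew-symmetric triangular splitting, P - W = I/\<omega> - H - \<omega> L_s L_s^T is symmetric and
  x^T (2P - W) x \<ge> (2/\<omega> - 2\<omega> |L_s|^2 - \<lambda>_max(H)) |x|^2. The bound on \<omega> says exactly that \<omega> lies
  below the positive root of 2 |L_s|^2 \<omega>^2 + \<lambda>_max(H) \<omega> - 2, which makes this positive.
\<close>

lemma inner_matrix_vector_transpose:
  fixes A :: "real^'n^'m"
  shows "(A *v x) \<bullet> y = x \<bullet> (transpose A *v y)"
  by (metis dot_lmul_matrix inner_commute transpose_matrix_vector)

lemma symmetric_matrix_if_self_adjoint:
  fixes Q :: "real^'n^'n"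
  assumes "\<And>x y. (Q *v x) \<bullet> y = x \<bullet> (Q *v y)"
  shows "transpose Q = Q"
proof -
  have "transpose Q *v y = Q *v y" for y
  proof -
    have "x \<bullet> (transpose Q *v y) = x \<bullet> (Q *v y)" for x
      using assms[of x y] by (simp add: inner_matrix_vector_transpose)
    then show ?thesis
      by (metis vector_eq_ldot)
  qed
  then show ?thesis
    by (simp add: matrix_eq)
qed

lemma transpose_add: "transpose (A + B) = transpose A + transpose B"
  by (simp add: transpose_def vec_eq_iff)

lemma transpose_diff: "transpose (A - B) = transpose A - transpose B"
  by (simp add: transpose_def vec_eq_iff)

lemma transpose_uminus: "transpose (- A) = - transpose A"
  by (simp add: transpose_def vec_eq_iff)

lemma matrix_vector_mult_uminus: "(- A) *v x = - (A *v x)"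
  for A :: "real^'n^'m"
  by (simp add: vec_eq_iff matrix_vector_mult_def sum_negf)

lemma matrix_add_rdistrib: "(A + B) ** C = A ** C + B ** C"
  by (simp add: matrix_matrix_mult_def vec_eq_iff sum.distrib algebra_simps)

lemma matrix_mul_scaleR_right: "A ** (k *\<^sub>R B) = k *\<^sub>R (A ** B)"
  for A :: "real^'n^'m" and B :: "real^'p^'n"
  by (simp add: vec_eq_iff matrix_matrix_mult_def sum_distrib_left algebra_simps)

lemma matrix_mul_uminus_left: "(- A) ** B = - (A ** B)"
  and matrix_mul_uminus_right: "A ** (- B) = - (A ** B)"
  for A :: "real^'n^'m" and B :: "real^'p^'n"
  by (simp_all add: vec_eq_iff matrix_matrix_mult_def sum_negf)

lemma kernel_orthogonal_transpose_range:
  fixes M :: "real^'n^'m"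
  assumes "M *v k = 0"
  shows "(transpose M *v w) \<bullet> k = 0"
  using assms by (metis inner_matrix_vector_transpose inner_zero_right inner_commute)

lemma norm_transpose_le_onorm:
  fixes L :: "real^'n^'m"
  shows "norm (transpose L *v x) \<le> onorm ((*v) L) * norm x"
proof -
  define y where "y = transpose L *v x"
  have "(norm y)\<^sup>2 = x \<bullet> (L *v y)"
    unfolding y_def power2_norm_eq_inner by (metis inner_matrix_vector_transpose transpose_transpose)
  also have "\<dots> \<le> norm x * norm (L *v y)"
    using Cauchy_Schwarz_ineq2 by (metis abs_le_D1)
  also have "\<dots> \<le> norm x * (onorm ((*v) L) * norm y)"
    by (simp add: mult_left_mono onorm[OF matrix_vector_mul_bounded_linear])
  finally have "norm y * norm y \<le> norm y * (onorm ((*v) L) * norm x)"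
    by (simp add: power2_eq_square algebra_simps)
  then show ?thesis
    unfolding y_def[symmetric]
    by (cases "y = 0") (simp_all add: onorm_pos_le[OF matrix_vector_mul_bounded_linear])
qed

lemma spec_norm_pos:
  fixes L :: "real^'n^'m"
  assumes "L \<noteq> 0"
  shows "spec_norm L > 0"
proof -
  obtain x where "L *v x \<noteq> 0"
    using assms by (metis matrix_eq matrix_vector_mult_0)
  then show ?thesis
    unfolding spec_norm_def using onorm_pos_lt[OF matrix_vector_mul_bounded_linear] by blast
qed

subsection \<open>The Moore--Penrose inverse\<close>

lemma orthogonal_projection_exists:
  fixes S :: "'a::euclidean_space set"
  obtains p where "linear p" "\<And>x. p x \<in> span S" "\<And>x w. w \<in> span S \<Longrightarrow> (x - p x) \<bullet> w = 0"
proof -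
  obtain T where T: "0 \<notin> T" "T \<subseteq> span S" "pairwise orthogonal T" "independent T"
    "card T = dim (span S)" "span T = span S"
    using orthogonal_basis_subspace subspace_span by blast
  define p where "p x = (\<Sum>b\<in>T. (b \<bullet> x / (b \<bullet> b)) *\<^sub>R b)" for x
  have "linear p"
    unfolding p_def
    by (intro linear_compose_sum ballI linearI)
       (auto simp: inner_add_right add_divide_distrib scaleR_add_left)
  moreover have "p x \<in> span S" for x
    unfolding p_def using T by (simp add: span_mul span_sum subsetD)
  moreover have "(x - p x) \<bullet> w = 0" if "w \<in> span S" for x w
    using Gram_Schmidt_step[OF T(3), of w x] that T(6) unfolding p_def orthogonal_def
    by (simp add: inner_commute)
  ultimately show ?thesis
    using that by blast
qed

lemma orthogonal_projection_self_adjoint: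
  assumes "\<And>x. p x \<in> span S" "\<And>x w. w \<in> span S \<Longrightarrow> (x - p x) \<bullet> w = 0"
  shows "p x \<bullet> y = x \<bullet> p y"
proof -
  have "p x \<bullet> y = p x \<bullet> p y + p x \<bullet> (y - p y)"
    by (simp add: inner_diff_right)
  moreover have "x \<bullet> p y = p x \<bullet> p y + (x - p x) \<bullet> p y"
    by (simp add: inner_diff_left)
  ultimately show ?thesis
    using assms by (simp add: inner_commute)
qed

lemma orthogonal_projection_fixes_span:
  assumes "\<And>x. p x \<in> span S" "\<And>x w. w \<in> span S \<Longrightarrow> (x - p x) \<bullet> w = 0" "z \<in> span S"
  shows "p z = z"
proof -
  have "z - p z \<in> span S"
    using assms by (simp add: span_diff)
  then have "(z - p z) \<bullet> (z - p z) = 0"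
    using assms by blast
  then show ?thesis
    by simp
qed

lemma image_row_space_eq_range:
  fixes M :: "real^'a^'b"
  shows "(*v) M ` range ((*v) (transpose M)) = range ((*v) M)"
proof
  let ?V = "range ((*v) (transpose M))"
  have span_V: "span ?V = ?V"
    by (metis span_UNIV span_linear_image matrix_vector_mul_linear)
  obtain pV where pV: "\<And>x. pV x \<in> span ?V" "\<And>x w. w \<in> span ?V \<Longrightarrow> (x - pV x) \<bullet> w = 0"
    using orthogonal_projection_exists[of ?V] by metis
  have pV_kernel: "M *v pV x = M *v x" for x
  proof -
    have "(x - pV x) \<bullet> (transpose M *v w) = 0" for w
      using pV(2) span_V by blast
    then have "(M *v (x - pV x)) \<bullet> (M *v (x - pV x)) = 0"
      by (metis inner_matrix_vector_transpose)
    then show ?thesis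
      by (simp add: matrix_vector_mult_diff_distrib)
  qed
  show "range ((*v) M) \<subseteq> (*v) M ` ?V"
  proof
    fix y assume "y \<in> range ((*v) M)"
    then obtain x where "y = M *v pV x"
      using pV_kernel by fastforce
    moreover have "pV x \<in> ?V"
      using pV(1)[of x] span_V by metis
    ultimately show "y \<in> (*v) M ` ?V"
      by blast
  qed
qed blast

lemma row_space_right_inverse:
  fixes M :: "real^'a^'b"
  obtains g where "linear g" "\<And>x. M *v g (M *v x) = M *v x"
    "\<And>x y. g (M *v x) \<bullet> y = x \<bullet> g (M *v y)"
proof -
  let ?V = "range ((*v) (transpose M))"
  have span_V: "span ?V = ?V"
    by (metis span_UNIV span_linear_image matrix_vector_mul_linear)
  have "(*v) M ` ?V = range ((*v) M)"
    by (rule image_row_space_eq_range)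
  moreover have "subspace ?V"
    by (metis span_V subspace_span)
  ultimately obtain g where g: "range g \<subseteq> ?V" "linear g" "\<And>x. M *v g (M *v x) = M *v x"
    using linear_exists_right_inverse_on[OF matrix_vector_mul_linear, of ?V M] by auto
  \<comment> \<open>\<open>g \<circ> (*v) M\<close> is the orthogonal projection onto the row space, the complement of the kernel\<close>
  have "g (M *v x) \<in> span ?V" for x
    using g(1) by (meson rangeI span_base subsetD)
  moreover have "(x - g (M *v x)) \<bullet> w = 0" if "w \<in> span ?V" for x w
  proof -
    have "M *v (x - g (M *v x)) = 0"
      using g(3) by (simp add: matrix_vector_mult_diff_distrib)
    moreover have "w \<in> ?V"
      using that unfolding span_V .
    then obtain w' where "w = transpose M *v w'"
      by blast
    ultimately show ?thesis
      using kernel_orthogonal_transpose_range[of M "x - g (M *v x)" w'] by (simp add: inner_commute)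
  qed
  ultimately have "g (M *v x) \<bullet> y = x \<bullet> g (M *v y)" for x y
    by (rule orthogonal_projection_self_adjoint[where p = "\<lambda>x. g (M *v x)"])
  then show ?thesis
    using that g(2,3) by blast
qed

lemma is_mp_inverse_exists: "\<exists>X. is_mp_inverse X (M :: real^'a^'b)"
proof -
  let ?R = "range ((*v) M)"
  have span_R: "span ?R = ?R"
    by (metis span_UNIV span_linear_image matrix_vector_mul_linear)
  obtain pR where pR: "linear pR" "\<And>x. pR x \<in> span ?R" "\<And>x w. w \<in> span ?R \<Longrightarrow> (x - pR x) \<bullet> w = 0"
    using orthogonal_projection_exists[of ?R] by metis
  obtain g where g: "linear g" "\<And>x. M *v g (M *v x) = M *v x"
    "\<And>x y. g (M *v x) \<bullet> y = x \<bullet> g (M *v y)"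
    using row_space_right_inverse[of M] by blast
  have pR_M: "pR (M *v x) = M *v x" for x
    using orthogonal_projection_fixes_span[OF pR(2,3)] span_R by auto
  have pR_idem: "pR (pR y) = pR y" for y
    by (rule orthogonal_projection_fixes_span[OF pR(2,3) pR(2)])
  have M_g_pR: "M *v g (pR y) = pR y" for y
    using g(2) pR(2)[of y] span_R by (metis rangeE)
  define X where "X = matrix (g \<circ> pR)"
  have X: "X *v y = g (pR y)" for y
    using matrix_vector_mul(2)[OF linear_compose[OF pR(1) g(1)]] unfolding X_def by (metis comp_apply)
  have "M ** X ** M = M"
    by (simp add: matrix_eq X g(2) pR_M flip: matrix_vector_mul_assoc)
  moreover have "X ** M ** X = X"
    by (simp add: matrix_eq X M_g_pR pR_idem flip: matrix_vector_mul_assoc)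
  moreover have "transpose (M ** X) = M ** X"
    by (rule symmetric_matrix_if_self_adjoint)
       (simp add: X M_g_pR orthogonal_projection_self_adjoint[OF pR(2,3)] flip: matrix_vector_mul_assoc)
  moreover have "transpose (X ** M) = X ** M"
    by (rule symmetric_matrix_if_self_adjoint)
       (simp add: X pR_M g(3) flip: matrix_vector_mul_assoc)
  ultimately show ?thesis
    unfolding is_mp_inverse_def by blast
qed

lemma is_mp_inverse_unique:
  fixes M :: "real^'a^'b"
  assumes "is_mp_inverse X M" "is_mp_inverse Y M"
  shows "X = Y"
proof -
  have X: "M ** X ** M = M" "X ** M ** X = X" "transpose (M ** X) = M ** X" "transpose (X ** M) = X ** M"
    using assms(1) unfolding is_mp_inverse_def by auto
  have Y: "M ** Y ** M = M" "Y ** M ** Y = Y" "transpose (M ** Y) = M ** Y" "transpose (Y ** M) = Y ** M"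
    using assms(2) unfolding is_mp_inverse_def by auto
  have "X = X ** (M ** X)" using X(2) by (simp add: matrix_mul_assoc)
  also have "\<dots> = X ** transpose (M ** X)" using X(3) by simp
  also have "\<dots> = X ** (transpose X ** transpose M)" by (simp add: matrix_transpose_mul)
  also have "transpose M = transpose (M ** Y ** M)" using Y(1) by simp
  also have "X ** (transpose X ** transpose (M ** Y ** M)) = X ** (transpose (M ** X) ** transpose (M ** Y))"
    by (simp add: matrix_transpose_mul matrix_mul_assoc)
  also have "\<dots> = X ** (M ** X ** (M ** Y))" using X(3) Y(3) by simp
  also have "\<dots> = X ** M ** Y" using X(2) by (simp add: matrix_mul_assoc)
  finally have eX: "X = X ** M ** Y" .
  have "Y = (Y ** M) ** Y" using Y(2) by (simp add: matrix_mul_assoc)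
  also have "\<dots> = transpose (Y ** M) ** Y" using Y(4) by simp
  also have "\<dots> = (transpose M ** transpose Y) ** Y" by (simp add: matrix_transpose_mul)
  also have "transpose M = transpose (M ** X ** M)" using X(1) by simp
  also have "(transpose (M ** X ** M) ** transpose Y) ** Y = (transpose (X ** M) ** transpose (Y ** M)) ** Y"
    by (simp add: matrix_transpose_mul matrix_mul_assoc)
  also have "\<dots> = X ** M ** (Y ** M ** Y)" using X(4) Y(4) by (simp add: matrix_mul_assoc)
  also have "\<dots> = X ** M ** Y" using Y(2) by simp
  finally have "Y = X ** M ** Y" .
  with eX show ?thesis by simp
qed

lemma is_mp_inverse_mp_inverse: "is_mp_inverse (mp_inverse M) (M :: real^'a^'b)"
  unfolding mp_inverse_def using is_mp_inverse_exists[of M] is_mp_inverse_unique[of _ M] by (metis theI)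

lemma penrose_residual_orthogonal:
  fixes M :: "real^'a^'b" and X :: "real^'b^'a"
  assumes "M ** X ** M = M" "transpose (M ** X) = M ** X"
  shows "(z - M *v (X *v z)) \<bullet> (M *v w) = 0"
proof -
  have "(M *v (X *v z)) \<bullet> (M *v w) = z \<bullet> ((M ** X ** M) *v w)"
    using assms(2) by (metis inner_matrix_vector_transpose matrix_vector_mul_assoc)
  then show ?thesis
    using assms(1) by (simp add: inner_diff_left)
qed

subsection \<open>Quadratic forms\<close>

lemma quadratic_form_scaleR:
  fixes Q :: "real^'n^'n"
  shows "(c *\<^sub>R x) \<bullet> (Q *v (c *\<^sub>R x)) = c\<^sup>2 * (x \<bullet> (Q *v x))"
  by (simp add: matrix_vector_mult_scaleR power2_eq_square)

lemma quadratic_form_le_max_on_sphere: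
  fixes Q :: "real^'n^'n"
  obtains x1 where "norm x1 = 1" "\<And>x. x \<bullet> (Q *v x) \<le> (x1 \<bullet> (Q *v x1)) * (x \<bullet> x)"
proof -
  have "continuous_on (sphere 0 1) (\<lambda>x. x \<bullet> (Q *v x))"
    by (intro continuous_intros linear_continuous_on matrix_vector_mul_bounded_linear)
  moreover have "sphere (0 :: real^'n) 1 \<noteq> {}"
    by (simp add: sphere_eq_empty)
  ultimately obtain x1 where x1: "x1 \<in> sphere 0 1"
    and max: "\<And>y. y \<in> sphere 0 1 \<Longrightarrow> y \<bullet> (Q *v y) \<le> x1 \<bullet> (Q *v x1)"
    using continuous_attains_sup[OF compact_sphere] by blast
  have "x \<bullet> (Q *v x) \<le> (x1 \<bullet> (Q *v x1)) * (x \<bullet> x)" for x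
  proof (cases "x = 0")
    case False
    define u where "u = x /\<^sub>R norm x"
    have "x = norm x *\<^sub>R u" and u: "u \<in> sphere 0 1"
      using False by (auto simp: u_def)
    then have "x \<bullet> (Q *v x) = (norm x)\<^sup>2 * (u \<bullet> (Q *v u))"
      by (metis quadratic_form_scaleR)
    also have "\<dots> \<le> (norm x)\<^sup>2 * (x1 \<bullet> (Q *v x1))"
      using max[OF u] by (simp add: mult_left_mono)
    finally show ?thesis
      by (simp add: power2_norm_eq_inner mult.commute)
  qed simp
  moreover have "norm x1 = 1"
    using x1 by simp
  ultimately show ?thesis
    using that by blast
qed

lemma positive_definite_coercive:
  fixes Q :: "real^'n^'n"
  assumes "\<And>x. x \<noteq> 0 \<Longrightarrow> x \<bullet> (Q *v x) > 0"
  obtains c where "c > 0" "\<And>x. c * (x \<bullet> x) \<le> x \<bullet> (Q *v x)"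
proof -
  obtain x1 where x1: "norm x1 = 1" "\<And>x. x \<bullet> (- Q *v x) \<le> (x1 \<bullet> (- Q *v x1)) * (x \<bullet> x)"
    using quadratic_form_le_max_on_sphere[of "- Q"] by blast
  show ?thesis
  proof
    show "x1 \<bullet> (Q *v x1) > 0"
      using assms x1(1) by (metis norm_zero zero_neq_one)
    show "(x1 \<bullet> (Q *v x1)) * (x \<bullet> x) \<le> x \<bullet> (Q *v x)" for x
      using x1(2)[of x] by (simp add: matrix_vector_mult_uminus)
  qed
qed

lemma psd_quadratic_form_eq_0_imp_kernel:
  fixes G :: "real^'n^'n"
  assumes sym: "transpose G = G" and psd: "\<And>y. 0 \<le> y \<bullet> (G *v y)"
    and zero: "x \<bullet> (G *v x) = 0"
  shows "G *v x = 0"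
proof -
  have "y \<bullet> (G *v x) = 0" for y
  proof -
    define a where "a = y \<bullet> (G *v x)"
    define c where "c = y \<bullet> (G *v y)"
    have "x \<bullet> (G *v y) = a"
      unfolding a_def by (metis inner_commute inner_matrix_vector_transpose sym)
    then have expand: "(x + t *\<^sub>R y) \<bullet> (G *v (x + t *\<^sub>R y)) = 2 * t * a + t\<^sup>2 * c" for t
      using zero unfolding a_def c_def
      by (simp add: matrix_vector_right_distrib matrix_vector_mult_scaleR inner_add_left
          inner_add_right inner_commute[of y "G *v x"] power2_eq_square algebra_simps)
    have "c \<ge> 0"
      unfolding c_def by (rule psd)
    \<comment> \<open>evaluate the nonnegative quadratic \<open>2 t a + t\<^sup>2 c\<close> at \<open>t = - a / (c + 1)\<close>\<close>
    have "0 \<le> 2 * (- a / (c + 1)) * a + (- a / (c + 1))\<^sup>2 * c"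
      using psd expand by metis
    also have "\<dots> = - (a\<^sup>2 * (c + 2)) / (c + 1)\<^sup>2"
      using \<open>c \<ge> 0\<close> by (simp add: divide_simps) (simp add: power2_eq_square algebra_simps)
    finally have "a\<^sup>2 * (c + 2) / (c + 1)\<^sup>2 \<le> 0"
      by simp
    then have "a\<^sup>2 * (c + 2) \<le> 0"
      using \<open>c \<ge> 0\<close> by (simp add: divide_le_0_iff)
    then show ?thesis
      using \<open>c \<ge> 0\<close> unfolding a_def by (simp add: mult_le_0_iff)
  qed
  then show ?thesis
    by (metis inner_eq_zero_iff)
qed

lemma symmetric_eigenvalues_finite:
  fixes H :: "real^'n^'n"
  assumes sym: "transpose H = H"
  shows "finite {l. \<exists>v. v \<noteq> 0 \<and> H *v v = l *\<^sub>R v}" (is "finite ?E")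
proof -
  define ev where "ev l = (SOME v. v \<noteq> 0 \<and> H *v v = l *\<^sub>R v)" for l
  have ev: "ev l \<noteq> 0 \<and> H *v ev l = l *\<^sub>R ev l" if "l \<in> ?E" for l
    unfolding ev_def by (rule someI_ex) (use that in simp)
  have "inj_on ev ?E"
  proof (rule inj_onI)
    fix a b assume a: "a \<in> ?E" and b: "b \<in> ?E" and eq: "ev a = ev b"
    have "a *\<^sub>R ev a = H *v ev a"
      using ev[OF a] by simp
    also have "\<dots> = b *\<^sub>R ev a"
      using ev[OF b] eq by simp
    finally show "a = b"
      using ev[OF a] by simp
  qed
  moreover have "orthogonal (ev a) (ev b)" if "a \<in> ?E" "b \<in> ?E" "a \<noteq> b" for a b
  proof -
    have "a * (ev a \<bullet> ev b) = (H *v ev a) \<bullet> ev b"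
      using ev[OF that(1)] by simp
    also have "\<dots> = ev a \<bullet> (H *v ev b)"
      by (subst inner_matrix_vector_transpose) (simp add: sym)
    also have "\<dots> = b * (ev a \<bullet> ev b)"
      using ev[OF that(2)] by simp
    finally show ?thesis
      unfolding orthogonal_def using that(3) by simp
  qed
  then have "pairwise orthogonal (ev ` ?E)"
    unfolding pairwise_def by blast
  ultimately show ?thesis
    using pairwise_orthogonal_imp_finite finite_imageD by blast
qed

lemma quadratic_form_le_lambda_max:
  fixes H :: "real^'n^'n"
  assumes sym: "transpose H = H"
  shows "x \<bullet> (H *v x) \<le> lambda_max H * (x \<bullet> x)"
proof -
  obtain x1 where x1: "norm x1 = 1" "\<And>x. x \<bullet> (H *v x) \<le> (x1 \<bullet> (H *v x1)) * (x \<bullet> x)"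
    using quadratic_form_le_max_on_sphere[of H] by blast
  define \<mu> where "\<mu> = x1 \<bullet> (H *v x1)"
  define G where "G = \<mu> *\<^sub>R mat 1 - H"
  have G: "y \<bullet> (G *v y) = \<mu> * (y \<bullet> y) - y \<bullet> (H *v y)" for y
    by (simp add: G_def matrix_vector_mult_diff_rdistrib inner_diff_right scaleR_matrix_vector_assoc[symmetric])
  \<comment> \<open>a maximiser of the Rayleigh quotient is an eigenvector\<close>
  have "G *v x1 = 0"
  proof (rule psd_quadratic_form_eq_0_imp_kernel)
    show "transpose G = G"
      using sym by (simp add: G_def transpose_diff transpose_scalar)
    show "0 \<le> y \<bullet> (G *v y)" for y
      using x1(2)[of y] by (simp add: G \<mu>_def mult.commute)
    show "x1 \<bullet> (G *v x1) = 0"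
      using x1(1) by (simp add: G \<mu>_def power2_norm_eq_inner[symmetric])
  qed
  then have "H *v x1 = \<mu> *\<^sub>R x1"
    by (simp add: G_def matrix_vector_mult_diff_rdistrib scaleR_matrix_vector_assoc[symmetric])
  moreover have "x1 \<noteq> 0"
    using x1(1) by auto
  ultimately have "\<mu> \<le> lambda_max H"
    unfolding lambda_max_def by (blast intro: Max_ge symmetric_eigenvalues_finite[OF sym])
  then show ?thesis
    using x1(2)[of x] unfolding \<mu>_def by (meson inner_ge_zero mult_right_mono order_trans)
qed

lemma quadratic_form_skew:
  fixes S :: "real^'n^'n"
  assumes "transpose S = - S"
  shows "x \<bullet> (S *v x) = 0"
  using inner_matrix_vector_transpose[of S x x] assms
  by (simp add: matrix_vector_mult_uminus inner_commute)

lemma inner_parallelogram: "(x + y) \<bullet> (x + y) + (x - y) \<bullet> (x - y) = 2 * (x \<bullet> x + y \<bullet> y)"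
  for x y :: "'a::real_inner"
  by (simp add: inner_add_left inner_add_right inner_diff_left inner_diff_right inner_commute[of y x])

subsection \<open>Saddle point matrices\<close>

definition inl_part :: "real^('n::finite + 'm::finite) \<Rightarrow> real^'n" where
  "inl_part e = (\<chi> i. e $ Inl i)"

definition inr_part :: "real^('n::finite + 'm::finite) \<Rightarrow> real^'m" where
  "inr_part e = (\<chi> j. e $ Inr j)"

definition join_parts :: "real^'n::finite \<Rightarrow> real^'m::finite \<Rightarrow> real^('n + 'm)" where
  "join_parts u v = (\<chi> k. case k of Inl i \<Rightarrow> u $ i | Inr j \<Rightarrow> v $ j)"

lemma sum_UNIV_Plus:
  "(\<Sum>k\<in>UNIV. f k) = (\<Sum>i\<in>UNIV. f (Inl i)) + (\<Sum>j\<in>UNIV. f (Inr j))"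
  for f :: "'a::finite + 'b::finite \<Rightarrow> 'c::comm_monoid_add"
  using sum.Plus[of "UNIV :: 'a set" "UNIV :: 'b set" f] by (simp add: o_def)

lemma inl_part_simps [simp]:
  "inl_part (a + b) = inl_part a + inl_part b" "inl_part (a - b) = inl_part a - inl_part b"
  "inl_part (c *\<^sub>R a) = c *\<^sub>R inl_part a" "inl_part 0 = 0" "inl_part (- a) = - inl_part a"
  "inl_part (join_parts u v) = u"
  by (auto simp: inl_part_def join_parts_def vec_eq_iff)

lemma inr_part_simps [simp]:
  "inr_part (a + b) = inr_part a + inr_part b" "inr_part (a - b) = inr_part a - inr_part b"
  "inr_part (c *\<^sub>R a) = c *\<^sub>R inr_part a" "inr_part 0 = 0" "inr_part (- a) = - inr_part a"
  "inr_part (join_parts u v) = v"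
  by (auto simp: inr_part_def join_parts_def vec_eq_iff)

lemma inner_parts: "e \<bullet> f = inl_part e \<bullet> inl_part f + inr_part e \<bullet> inr_part f"
  unfolding inner_vec_def inl_part_def inr_part_def by (simp add: sum_UNIV_Plus)

lemma norm_eq_norm_inl_part: "inr_part e = 0 \<Longrightarrow> norm e = norm (inl_part e)"
  by (simp add: norm_eq_sqrt_inner inner_parts[of e e])

lemma inl_part_saddle: "inl_part (saddle X B *v e) = X *v inl_part e + transpose B *v inr_part e"
  unfolding inl_part_def inr_part_def saddle_def
  by (simp add: vec_eq_iff matrix_vector_mult_def transpose_def sum_UNIV_Plus)

lemma inr_part_saddle: "inr_part (saddle X B *v e) = - (B *v inl_part e)"
  unfolding inl_part_def inr_part_def saddle_def
  by (simp add: vec_eq_iff matrix_vector_mult_def sum_negf sum_UNIV_Plus)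

lemma saddle_diff_apply:
  "(saddle P B - saddle W B) *v e = join_parts ((P - W) *v inl_part e) 0"
  by (simp add: vec_eq_iff saddle_def join_parts_def inl_part_def matrix_vector_mult_def
      sum_UNIV_Plus algebra_simps sum_subtractf split: sum.split)

lemma saddle_range_orthogonal:
  fixes P W :: "real^'n^'n" and B :: "real^'n^'m"
  assumes P: "\<And>x. x \<noteq> 0 \<Longrightarrow> x \<bullet> (P *v x) > 0"
    and r: "\<And>w. r \<bullet> (saddle P B *v w) = 0"
  shows "r \<bullet> (saddle W B *v e) = 0"
proof -
  have B_dual: "(B *v x) \<bullet> y = x \<bullet> (transpose B *v y)" for x y
    by (rule inner_matrix_vector_transpose)
  have "(B *v inl_part r) \<bullet> (B *v inl_part r) = 0"
    using r[of "join_parts 0 (B *v inl_part r)"] by (simp add: inner_parts[of r] inl_part_saddle inr_part_saddle B_dual inner_commute)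
  then have Br: "B *v inl_part r = 0"
    by simp
  have "inl_part r \<bullet> (P *v inl_part r) = 0"
    using r[of "join_parts (inl_part r) 0"] by (simp add: inner_parts[of r] inl_part_saddle inr_part_saddle Br)
  then have r1: "inl_part r = 0"
    using P by fastforce
  have "inr_part r \<bullet> (B *v (transpose B *v inr_part r)) = 0"
    using r[of "join_parts (transpose B *v inr_part r) 0"]
    by (simp add: inner_parts[of r] inl_part_saddle inr_part_saddle r1)
  then have "(transpose B *v inr_part r) \<bullet> (transpose B *v inr_part r) = 0"
    by (metis B_dual inner_commute)
  then have "transpose B *v inr_part r = 0"
    by (simp only: inner_eq_zero_iff)
  then have "inr_part r \<bullet> (B *v inl_part e) = 0"
    by (metis B_dual inner_commute inner_zero_left)
  then show ?thesis
    by (simp add: inner_parts[of r] inl_part_saddle inr_part_saddle r1)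
qed

lemma saddle_mp_inverse_fixes_range:
  fixes P W :: "real^'n^'n" and B :: "real^'n^'m"
  assumes P: "\<And>x. x \<noteq> 0 \<Longrightarrow> x \<bullet> (P *v x) > 0"
    and X: "is_mp_inverse X (saddle P B)"
  shows "saddle P B *v (X *v (saddle W B *v e)) = saddle W B *v e"
proof -
  define z where "z = saddle W B *v e"
  define r where "r = z - saddle P B *v (X *v z)"
  have r_orth: "r \<bullet> (saddle P B *v w) = 0" for w
    using X penrose_residual_orthogonal unfolding r_def is_mp_inverse_def by blast
  then have "r \<bullet> z = 0"
    unfolding z_def using saddle_range_orthogonal[OF P] by blast
  then have "r \<bullet> r = 0"
    using r_orth[of "X *v z"] by (simp add: r_def inner_diff_right)
  then show ?thesis
    unfolding r_def z_def by simp
qed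

subsection \<open>Convergence of the saddle point iteration\<close>

lemma saddle_energy_identity:
  fixes P W :: "real^'n^'n" and B :: "real^'n^'m"
  assumes Bu': "B *v u' = 0"
    and rel: "P *v u' + transpose B *v v' = (P - W) *v u"
    and sym: "transpose (P - W) = P - W"
  shows "2 * (u \<bullet> (P *v u) - u' \<bullet> (P *v u'))
    = (u + u') \<bullet> (W *v (u + u')) + (u - u') \<bullet> ((2 *\<^sub>R P - W) *v (u - u'))"
proof -
  have "u' \<bullet> (transpose B *v v') = 0"
    using Bu' by (metis inner_matrix_vector_transpose inner_zero_left transpose_transpose)
  then have D_u: "u' \<bullet> ((P - W) *v u) = u' \<bullet> (P *v u')"
    by (simp add: rel[symmetric] inner_add_right)
  moreover have "u \<bullet> ((P - W) *v u') = u' \<bullet> ((P - W) *v u)"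
    by (metis inner_commute inner_matrix_vector_transpose sym)
  ultimately show ?thesis
    by (simp add: matrix_vector_right_distrib matrix_vector_mult_diff_distrib
        matrix_vector_mult_diff_rdistrib matrix_vector_mult_add_rdistrib inner_add_left inner_add_right
        inner_diff_left inner_diff_right inner_commute[of u' "W *v u"] inner_commute[of u' "P *v u"]
        algebra_simps flip: scaleR_matrix_vector_assoc)
qed

lemma saddle_energy_decrease:
  fixes P W :: "real^'n^'n" and B :: "real^'n^'m"
  assumes "B *v u' = 0" "P *v u' + transpose B *v v' = (P - W) *v u" "transpose (P - W) = P - W"
    and W: "\<And>x. h * (x \<bullet> x) \<le> x \<bullet> (W *v x)"
    and D: "\<And>x. c * (x \<bullet> x) \<le> x \<bullet> ((2 *\<^sub>R P - W) *v x)"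
    and "0 \<le> m" "m \<le> h" "m \<le> c"
  shows "m * (u \<bullet> u) \<le> u \<bullet> (P *v u) - u' \<bullet> (P *v u')"
proof -
  define p q where "p = (u + u') \<bullet> (u + u')" and "q = (u - u') \<bullet> (u - u')"
  have "0 \<le> p" "0 \<le> q"
    by (simp_all add: p_def q_def)
  have "2 * (m * (u \<bullet> u)) \<le> 2 * (m * (u \<bullet> u + u' \<bullet> u'))"
    using \<open>0 \<le> m\<close> by (simp add: mult_left_mono)
  also have "\<dots> = m * p + m * q"
    using inner_parallelogram[of u u'] unfolding p_def q_def by (simp add: algebra_simps)
  also have "\<dots> \<le> h * p + c * q"
    using \<open>m \<le> h\<close> \<open>m \<le> c\<close> \<open>0 \<le> p\<close> \<open>0 \<le> q\<close> by (intro add_mono mult_right_mono) auto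
  also have "\<dots> \<le> 2 * (u \<bullet> (P *v u) - u' \<bullet> (P *v u'))"
    using W[of "u + u'"] D[of "u - u'"] saddle_energy_identity[OF assms(1-3)]
    unfolding p_def q_def by linarith
  finally show ?thesis
    by simp
qed

lemma summable_sqrt_if_contracting:
  fixes a :: "nat \<Rightarrow> real"
  assumes "\<And>k. 0 \<le> a k" "\<And>k. a (Suc k) \<le> q * a k" "0 \<le> q" "q < 1"
  shows "summable (\<lambda>k. sqrt (a k))"
proof (rule summable_ratio_test)
  show "sqrt q < 1"
    using assms(4) by simp
  show "norm (sqrt (a (Suc k))) \<le> sqrt q * norm (sqrt (a k))" for k
    using assms(1,2) by (simp add: real_sqrt_mult[symmetric])
qed

lemma summable_norm_if_energy_contracts:
  fixes P :: "real^'n^'n" and u :: "nat \<Rightarrow> real^'n"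
  assumes "a > 0" and P: "\<And>x. a * (x \<bullet> x) \<le> x \<bullet> (P *v x)"
    and contract: "\<And>k. u (Suc k) \<bullet> (P *v u (Suc k)) \<le> q * (u k \<bullet> (P *v u k))"
    and "0 \<le> q" "q < 1"
  shows "summable (\<lambda>k. norm (u k))"
proof -
  define V where "V k = u k \<bullet> (P *v u k)" for k
  have V_lower: "a * (u k \<bullet> u k) \<le> V k" for k
    unfolding V_def by (rule P)
  have "0 \<le> V k" for k
  proof -
    have "0 \<le> a * (u k \<bullet> u k)"
      using \<open>a > 0\<close> by simp
    then show ?thesis
      using V_lower[of k] by linarith
  qed
  then have "summable (\<lambda>k. sqrt (V k))"
    using contract \<open>0 \<le> q\<close> \<open>q < 1\<close> unfolding V_def[symmetric] by (rule summable_sqrt_if_contracting)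
  then have "summable (\<lambda>k. sqrt (V k) / sqrt a)"
    by (rule summable_divide)
  moreover have "norm (norm (u k)) \<le> sqrt (V k) / sqrt a" for k
    using V_lower[of k] \<open>a > 0\<close>
    by (simp add: norm_eq_sqrt_inner real_sqrt_divide[symmetric] pos_le_divide_eq mult.commute)
  ultimately show ?thesis
    by (rule summable_comparison_test'[where N = 0])
qed

lemma saddle_errors_summable:
  fixes P W :: "real^'n^'n" and B :: "real^'n^'m"
  assumes Bu: "\<And>k. B *v u (Suc k) = 0"
    and rel: "\<And>k. P *v u (Suc k) + transpose B *v v (Suc k) = (P - W) *v u k"
    and sym: "transpose (P - W) = P - W"
    and W_pd: "\<And>x. x \<noteq> 0 \<Longrightarrow> x \<bullet> (W *v x) > 0"
    and D_pd: "\<And>x. x \<noteq> 0 \<Longrightarrow> x \<bullet> ((2 *\<^sub>R P - W) *v x) > 0"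
  shows "summable (\<lambda>k. norm (u k))"
proof -
  obtain h where h: "h > 0" "\<And>x. h * (x \<bullet> x) \<le> x \<bullet> (W *v x)"
    using positive_definite_coercive[OF W_pd] by blast
  obtain c where c: "c > 0" "\<And>x. c * (x \<bullet> x) \<le> x \<bullet> ((2 *\<^sub>R P - W) *v x)"
    using positive_definite_coercive[OF D_pd] by blast
  obtain x1 where x1: "\<And>x. x \<bullet> (P *v x) \<le> (x1 \<bullet> (P *v x1)) * (x \<bullet> x)"
    using quadratic_form_le_max_on_sphere[of P] by blast
  define \<kappa> where "\<kappa> = min h c"
  define p where "p = max (x1 \<bullet> (P *v x1)) \<kappa>"
  have "\<kappa> > 0" "p \<ge> \<kappa>"
    using h c by (auto simp: \<kappa>_def p_def)
  have P_upper: "x \<bullet> (P *v x) \<le> p * (x \<bullet> x)" for x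
    by (rule order_trans[OF x1]) (simp add: p_def mult_right_mono)
  have P_lower: "(h + c) / 2 * (x \<bullet> x) \<le> x \<bullet> (P *v x)" for x
    using h(2)[of x] c(2)[of x]
    by (simp add: matrix_vector_mult_diff_rdistrib inner_diff_right algebra_simps
        flip: scaleR_matrix_vector_assoc)
  have "u (Suc k) \<bullet> (P *v u (Suc k)) \<le> (1 - \<kappa> / p) * (u k \<bullet> (P *v u k))" for k
  proof -
    have "\<kappa> * (u k \<bullet> u k) \<le> u k \<bullet> (P *v u k) - u (Suc k) \<bullet> (P *v u (Suc k))"
      by (rule saddle_energy_decrease[OF Bu rel sym h(2) c(2)]) (use h c in \<open>auto simp: \<kappa>_def\<close>)
    moreover have "\<kappa> / p * (u k \<bullet> (P *v u k)) \<le> \<kappa> * (u k \<bullet> u k)"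
      using P_upper[of "u k"] \<open>\<kappa> > 0\<close> \<open>p \<ge> \<kappa>\<close> by (simp add: divide_le_eq mult.commute mult_left_mono)
    ultimately show ?thesis
      by (simp add: algebra_simps)
  qed
  moreover have "0 \<le> 1 - \<kappa> / p" "1 - \<kappa> / p < 1"
    using \<open>\<kappa> > 0\<close> \<open>p \<ge> \<kappa>\<close> by simp_all
  moreover have "(h + c) / 2 > 0"
    using h c by simp
  ultimately show ?thesis
    using P_lower summable_norm_if_energy_contracts by blast
qed

lemma iterate_convergent_if_residuals_summable:
  fixes A M :: "real^'k^'k"
  assumes summable_r: "summable (\<lambda>k. norm (b - A *v iterate M A b x0 k))"
  shows "\<exists>x. (\<lambda>k. iterate M A b x0 k) \<longlonglongrightarrow> x \<and> A *v x = b"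
proof -
  define x where "x k = iterate M A b x0 k" for k
  define r where "r k = b - A *v x k" for k
  define d where "d k = x (Suc k) - x k" for k
  have "norm (d k) \<le> onorm ((*v) (mp_inverse M)) * norm (r k)" for k
    by (simp add: d_def x_def r_def onorm[OF matrix_vector_mul_bounded_linear])
  then have "summable (\<lambda>k. norm (d k))"
    by (intro summable_comparison_test'[OF summable_mult[OF summable_r[folded x_def r_def]], where N = 0])
       simp
  then have "summable d"
    by (rule summable_norm_cancel)
  then have "(\<lambda>k. x 0 + (\<Sum>i<k. d i)) \<longlonglongrightarrow> x 0 + suminf d"
    by (intro tendsto_add tendsto_const summable_LIMSEQ)
  moreover have "x 0 + (\<Sum>i<k. d i) = x k" for k
    by (simp add: d_def sum_lessThan_telescope)
  ultimately have lim: "x \<longlonglongrightarrow> x 0 + suminf d"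
    by simp
  have "(\<lambda>k. norm (r k)) \<longlonglongrightarrow> 0"
    using summable_LIMSEQ_zero[OF summable_r] by (simp add: r_def x_def)
  then have "(\<lambda>k. b - r k) \<longlonglongrightarrow> b - 0"
    by (intro tendsto_diff tendsto_const) (simp add: tendsto_norm_zero_iff)
  then have "(\<lambda>k. A *v x k) \<longlonglongrightarrow> b"
    by (simp add: r_def)
  moreover have "(\<lambda>k. A *v x k) \<longlonglongrightarrow> A *v (x 0 + suminf d)"
    by (rule bounded_linear.tendsto[OF matrix_vector_mul_bounded_linear lim])
  ultimately have "A *v (x 0 + suminf d) = b"
    by (rule LIMSEQ_unique[rotated])
  then show ?thesis
    using lim unfolding x_def by blast
qed

lemma iterate_error_step:
  fixes A M :: "real^'k^'k"
  assumes range_fixed: "\<And>e. M *v (mp_inverse M *v (A *v e)) = A *v e" and b: "b = A *v y"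
  shows "M *v (iterate M A b x0 (Suc k) - y) = (M - A) *v (iterate M A b x0 k - y)"
proof -
  define e where "e = iterate M A b x0 k - y"
  have "iterate M A b x0 (Suc k) - y = e - mp_inverse M *v (A *v e)"
    by (simp add: e_def b matrix_vector_mult_diff_distrib)
  then have "M *v (iterate M A b x0 (Suc k) - y) = M *v e - A *v e"
    by (simp add: matrix_vector_mult_diff_distrib range_fixed)
  then show ?thesis
    by (simp add: e_def matrix_vector_mult_diff_rdistrib)
qed

lemma saddle_error_blocks:
  fixes P W :: "real^'n^'n" and B :: "real^'n^'m"
  assumes "saddle P B *v e' = (saddle P B - saddle W B) *v e"
  shows "B *v inl_part e' = 0"
    and "P *v inl_part e' + transpose B *v inr_part e' = (P - W) *v inl_part e"
  using arg_cong[OF assms, of inr_part] arg_cong[OF assms, of inl_part]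
  by (simp_all add: saddle_diff_apply inl_part_saddle inr_part_saddle)

lemma norm_saddle_next_error:
  fixes P W :: "real^'n^'n" and B :: "real^'n^'m"
  assumes "saddle P B *v e' = (saddle P B - saddle W B) *v e"
  shows "norm (saddle W B *v e') = norm ((P - W) *v (inl_part e - inl_part e'))"
proof -
  have "saddle W B *v e' = (saddle P B - saddle W B) *v (e - e')"
    using assms by (simp add: matrix_vector_mult_diff_distrib matrix_vector_mult_diff_rdistrib)
  then show ?thesis
    by (simp add: saddle_diff_apply norm_eq_norm_inl_part)
qed

lemma positive_definite_if_twice_minus:
  fixes P W :: "real^'n^'n"
  assumes "x \<bullet> (W *v x) > 0" "x \<bullet> ((2 *\<^sub>R P - W) *v x) > 0"
  shows "x \<bullet> (P *v x) > 0"
  using assms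
  by (simp add: matrix_vector_mult_diff_rdistrib inner_diff_right flip: scaleR_matrix_vector_assoc)

lemma saddle_iteration_convergent:
  fixes P W :: "real^'n^'n" and B :: "real^'n^'m"
  assumes W_pd: "\<And>x. x \<noteq> 0 \<Longrightarrow> x \<bullet> (W *v x) > 0"
    and sym: "transpose (P - W) = P - W"
    and D_pd: "\<And>x. x \<noteq> 0 \<Longrightarrow> x \<bullet> ((2 *\<^sub>R P - W) *v x) > 0"
    and "b \<in> range ((*v) (saddle W B))"
  shows "\<exists>x. (\<lambda>k. iterate (saddle P B) (saddle W B) b x0 k) \<longlonglongrightarrow> x \<and> saddle W B *v x = b"
proof -
  let ?M = "saddle P B" and ?A = "saddle W B"
  obtain y where b: "b = ?A *v y"
    using assms(4) by blast
  have P_pd: "x \<bullet> (P *v x) > 0" if "x \<noteq> 0" for x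
    using positive_definite_if_twice_minus W_pd D_pd that by blast
  define e where "e k = iterate ?M ?A b x0 k - y" for k
  have step: "?M *v e (Suc k) = (?M - ?A) *v e k" for k
    unfolding e_def
    by (rule iterate_error_step[OF saddle_mp_inverse_fixes_range[OF P_pd is_mp_inverse_mp_inverse] b])
  define u where "u k = inl_part (e k)" for k
  have summable_u: "summable (\<lambda>k. norm (u k))"
    by (rule saddle_errors_summable[OF _ _ sym W_pd D_pd, where v = "\<lambda>k. inr_part (e k)"])
       (use saddle_error_blocks[OF step] in \<open>auto simp: u_def\<close>)
  have bound: "norm (b - ?A *v iterate ?M ?A b x0 (Suc k))
      \<le> onorm ((*v) (P - W)) * (norm (u k) + norm (u (Suc k)))" for k
  proof -
    have "b - ?A *v iterate ?M ?A b x0 (Suc k) = - (?A *v e (Suc k))"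
      by (simp add: b e_def matrix_vector_mult_diff_distrib)
    then have "norm (b - ?A *v iterate ?M ?A b x0 (Suc k)) = norm ((P - W) *v (u k - u (Suc k)))"
      unfolding u_def using norm_saddle_next_error[OF step] by simp
    also have "\<dots> \<le> onorm ((*v) (P - W)) * norm (u k - u (Suc k))"
      by (rule onorm[OF matrix_vector_mul_bounded_linear])
    also have "\<dots> \<le> onorm ((*v) (P - W)) * (norm (u k) + norm (u (Suc k)))"
      by (intro mult_left_mono norm_triangle_ineq4 onorm_pos_le matrix_vector_mul_bounded_linear)
    finally show ?thesis .
  qed
  have "summable (\<lambda>k. onorm ((*v) (P - W)) * (norm (u k) + norm (u (Suc k))))"
    using summable_u summable_Suc_iff[where f = "\<lambda>k. norm (u k)"] by (intro summable_mult summable_add) auto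
  then have "summable (\<lambda>k. norm (b - ?A *v iterate ?M ?A b x0 (Suc k)))"
    by (rule summable_comparison_test'[where N = 0]) (simp add: bound del: iterate.simps)
  then have "summable (\<lambda>k. norm (b - ?A *v iterate ?M ?A b x0 k))"
    by (subst summable_Suc_iff[symmetric])
  then show ?thesis
    by (rule iterate_convergent_if_residuals_summable)
qed

subsection \<open>The skew-symmetric triangular splitting\<close>

definition sym_part :: "real^'n^'n \<Rightarrow> real^'n^'n" where
  "sym_part W = (1/2) *\<^sub>R (W + transpose W)"

definition skew_part :: "real^'n^'n \<Rightarrow> real^'n^'n" where
  "skew_part W = (1/2) *\<^sub>R (W - transpose W)"

text \<open>Skew-symmetric triangular splitting: for S = skew_part W this is the matrix P of the statement.\<close>

definition sts_matrix ::
  "real \<Rightarrow> real^'n::{finite,linorder}^'n::{finite,linorder} \<Rightarrow> real^'n::{finite,linorder}^'n::{finite,linorder}"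
where
  "sts_matrix \<omega> S = (1/\<omega>) *\<^sub>R ((mat 1 + \<omega> *\<^sub>R lower_part S) ** (mat 1 + \<omega> *\<^sub>R upper_part S))"

lemma transpose_sym_part: "transpose (sym_part W) = sym_part W"
  by (simp add: sym_part_def transpose_def vec_eq_iff add.commute)

lemma transpose_skew_part: "transpose (skew_part W) = - skew_part W"
  by (simp add: skew_part_def transpose_def vec_eq_iff algebra_simps)

lemma sym_part_plus_skew_part: "sym_part W + skew_part W = W"
  by (simp add: sym_part_def skew_part_def vec_eq_iff field_simps)

lemma skew_entry:
  assumes "transpose S = - S"
  shows "S $ i $ j = - S $ j $ i"
  using arg_cong[OF assms, of "\<lambda>M. M $ j $ i"] by (simp add: transpose_def)

lemma upper_part_skew:
  assumes "transpose S = - S"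
  shows "upper_part S = - transpose (lower_part S)"
proof -
  have "upper_part S $ i $ j = - transpose (lower_part S) $ i $ j" for i j
    using skew_entry[OF assms, of i j] by (simp add: upper_part_def lower_part_def transpose_def)
  then show ?thesis
    by (simp add: vec_eq_iff)
qed

lemma lower_part_plus_upper_part_skew:
  assumes "transpose S = - S"
  shows "lower_part S + upper_part S = S"
proof -
  have "S $ i $ i = 0" for i
    using skew_entry[OF assms, of i i] by simp
  moreover have "i = j" if "\<not> j < i" "\<not> i < j" for i j :: 'a
    using that by simp
  ultimately show ?thesis
    by (auto simp: vec_eq_iff upper_part_def lower_part_def)
qed

lemma sts_matrix_expand:
  assumes "\<omega> \<noteq> 0"
  shows "sts_matrix \<omega> S
    = (1/\<omega>) *\<^sub>R mat 1 + (lower_part S + upper_part S) + \<omega> *\<^sub>R (lower_part S ** upper_part S)"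
  using assms
  by (simp add: sts_matrix_def matrix_add_ldistrib matrix_add_rdistrib matrix_mul_scaleR_right
      scaleR_add_right flip: scalar_matrix_assoc)

lemma sts_matrix_minus_symmetric:
  fixes W :: "real^'n::{finite,linorder}^'n::{finite,linorder}"
  assumes "\<omega> \<noteq> 0"
  shows "transpose (sts_matrix \<omega> (skew_part W) - W) = sts_matrix \<omega> (skew_part W) - W"
proof -
  define L where "L = lower_part (skew_part W)"
  define U where "U = upper_part (skew_part W)"
  have U: "U = - transpose L"
    unfolding U_def L_def using upper_part_skew transpose_skew_part by blast
  \<comment> \<open>the skew part cancels, leaving only symmetric terms: \<open>L U = - L L\<^sup>T\<close>\<close>
  have "sts_matrix \<omega> (skew_part W) - W
      = ((1/\<omega>) *\<^sub>R mat 1 + skew_part W + \<omega> *\<^sub>R (L ** U)) - (sym_part W + skew_part W)"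
    using sts_matrix_expand[OF assms, of "skew_part W"]
      lower_part_plus_upper_part_skew[OF transpose_skew_part]
    by (simp add: L_def U_def sym_part_plus_skew_part)
  also have "\<dots> = (1/\<omega>) *\<^sub>R mat 1 + \<omega> *\<^sub>R (L ** U) - sym_part W"
    by (simp add: algebra_simps)
  finally have "sts_matrix \<omega> (skew_part W) - W = (1/\<omega>) *\<^sub>R mat 1 + \<omega> *\<^sub>R (L ** U) - sym_part W" .
  moreover have "transpose (L ** U) = L ** U"
    by (simp add: U matrix_transpose_mul transpose_uminus matrix_mul_uminus_left matrix_mul_uminus_right)
  ultimately show ?thesis
    by (simp add: transpose_diff transpose_add transpose_scalar transpose_sym_part)
qed

lemma sts_quadratic_form:
  assumes skew: "transpose S = - S" and "\<omega> \<noteq> 0"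
  shows "x \<bullet> (sts_matrix \<omega> S *v x) = (1/\<omega>) * (x \<bullet> x) - \<omega> * (norm (upper_part S *v x))\<^sup>2"
proof -
  have "x \<bullet> (lower_part S *v (upper_part S *v x)) = - (upper_part S *v x) \<bullet> (upper_part S *v x)"
    using inner_matrix_vector_transpose[of "transpose (lower_part S)" x "upper_part S *v x"]
    by (simp add: upper_part_skew[OF skew] matrix_vector_mult_uminus)
  moreover have "x \<bullet> ((lower_part S + upper_part S) *v x) = 0"
    by (simp add: lower_part_plus_upper_part_skew[OF skew] quadratic_form_skew[OF skew])
  ultimately show ?thesis
    by (simp add: sts_matrix_expand[OF \<open>\<omega> \<noteq> 0\<close>] matrix_vector_mult_add_rdistrib inner_add_right
        scaleR_matrix_vector_assoc[symmetric] power2_norm_eq_inner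
        flip: matrix_vector_mul_assoc)
qed

lemma norm_upper_part_le:
  assumes "transpose S = - S"
  shows "norm (upper_part S *v x) \<le> spec_norm (lower_part S) * norm x"
  using norm_transpose_le_onorm[of "lower_part S" x]
  by (simp add: upper_part_skew[OF assms] matrix_vector_mult_uminus spec_norm_def)

lemma quadratic_form_le_lambda_max_sym_part:
  fixes W :: "real^'n^'n"
  shows "x \<bullet> (W *v x) \<le> lambda_max (sym_part W) * (x \<bullet> x)"
proof -
  have "x \<bullet> (W *v x) = x \<bullet> (sym_part W *v x) + x \<bullet> (skew_part W *v x)"
    by (metis inner_add_right matrix_vector_mult_add_rdistrib sym_part_plus_skew_part)
  then show ?thesis
    using quadratic_form_le_lambda_max[of "sym_part W" x, OF transpose_sym_part]
      quadratic_form_skew[of "skew_part W" x, OF transpose_skew_part] by simp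
qed

lemma quadratic_less_below_positive_root:
  fixes a b c x :: real
  assumes "a > 0" "c > 0" "x > 0" and x: "x < (- b + sqrt (b\<^sup>2 + 4 * a * c)) / (2 * a)"
  shows "a * x\<^sup>2 + b * x < c"
proof (cases "2 * a * x + b \<ge> 0")
  case True
  have "2 * a * x + b < sqrt (b\<^sup>2 + 4 * a * c)"
    using x \<open>a > 0\<close> by (simp add: pos_less_divide_eq mult.commute)
  then have "(2 * a * x + b)\<^sup>2 < b\<^sup>2 + 4 * a * c"
    using True by (metis real_sqrt_less_iff real_sqrt_unique)
  then have "4 * a * (a * x\<^sup>2 + b * x) < 4 * a * c"
    by (simp add: power2_eq_square algebra_simps)
  then show ?thesis
    using \<open>a > 0\<close> by simp
next
  case False
  moreover have "a * x > 0"
    using \<open>a > 0\<close> \<open>x > 0\<close> by simp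
  ultimately have "x * (a * x + b) < 0"
    using \<open>x > 0\<close> by (simp add: mult_pos_neg)
  then have "a * x\<^sup>2 + b * x < 0"
    by (simp add: power2_eq_square algebra_simps)
  then show ?thesis
    using \<open>c > 0\<close> by simp
qed

lemma sts_twice_minus_positive_definite:
  fixes W :: "real^'n::{finite,linorder}^'n::{finite,linorder}"
  assumes "\<omega> > 0" "x \<noteq> 0"
    and bound: "2 * (spec_norm (lower_part (skew_part W)))\<^sup>2 * \<omega>\<^sup>2 + lambda_max (sym_part W) * \<omega> < 2"
  shows "x \<bullet> ((2 *\<^sub>R sts_matrix \<omega> (skew_part W) - W) *v x) > 0"
proof -
  define L where "L = spec_norm (lower_part (skew_part W))"
  define lam where "lam = lambda_max (sym_part W)"
  have "\<omega> \<noteq> 0"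
    using \<open>\<omega> > 0\<close> by simp
  have "norm (upper_part (skew_part W) *v x) \<le> L * norm x"
    unfolding L_def by (rule norm_upper_part_le[OF transpose_skew_part])
  then have U: "(norm (upper_part (skew_part W) *v x))\<^sup>2 \<le> L\<^sup>2 * (x \<bullet> x)"
    by (metis norm_ge_zero power_mono power_mult_distrib power2_norm_eq_inner)
  have "\<omega> * (norm (upper_part (skew_part W) *v x))\<^sup>2 \<le> \<omega> * (L\<^sup>2 * (x \<bullet> x))"
    using U \<open>\<omega> > 0\<close> by (simp add: mult_left_mono)
  moreover have "2 * (x \<bullet> (sts_matrix \<omega> (skew_part W) *v x))
      = 2 / \<omega> * (x \<bullet> x) - 2 * (\<omega> * (norm (upper_part (skew_part W) *v x))\<^sup>2)"
    by (simp add: sts_quadratic_form[OF transpose_skew_part \<open>\<omega> \<noteq> 0\<close>] algebra_simps)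
  moreover have "(2 / \<omega> - 2 * \<omega> * L\<^sup>2 - lam) * (x \<bullet> x)
      = 2 / \<omega> * (x \<bullet> x) - 2 * (\<omega> * (L\<^sup>2 * (x \<bullet> x))) - lam * (x \<bullet> x)"
    by (simp add: algebra_simps)
  ultimately have "(2 / \<omega> - 2 * \<omega> * L\<^sup>2 - lam) * (x \<bullet> x)
      \<le> 2 * (x \<bullet> (sts_matrix \<omega> (skew_part W) *v x)) - x \<bullet> (W *v x)"
    using quadratic_form_le_lambda_max_sym_part[of x W] unfolding lam_def by linarith
  moreover have "2 / \<omega> - 2 * \<omega> * L\<^sup>2 - lam = (2 - (2 * L\<^sup>2 * \<omega>\<^sup>2 + lam * \<omega>)) / \<omega>"
    using \<open>\<omega> > 0\<close> by (simp add: field_simps power2_eq_square)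
  then have "2 / \<omega> - 2 * \<omega> * L\<^sup>2 - lam > 0"
    using bound \<open>\<omega> > 0\<close> unfolding L_def lam_def by simp
  then have "(2 / \<omega> - 2 * \<omega> * L\<^sup>2 - lam) * (x \<bullet> x) > 0"
    using \<open>x \<noteq> 0\<close> by simp
  ultimately have "2 * (x \<bullet> (sts_matrix \<omega> (skew_part W) *v x)) - x \<bullet> (W *v x) > 0"
    by linarith
  then show ?thesis
    by (simp add: matrix_vector_mult_diff_rdistrib inner_diff_right
        flip: scaleR_matrix_vector_assoc)
qed

theorem theorem3:
  fixes W :: "real^'n::{finite,linorder}^'n::{finite,linorder}"
    and B :: "real^'n::{finite,linorder}^'m::finite"
    and b :: "real^('n::{finite,linorder} + 'm::finite)"
    and \<omega> :: real
  assumes posdef: "\<And>x. x \<noteq> 0 \<Longrightarrow> x \<bullet> (W *v x) > 0"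
    and Ls_nz: "lower_part ((1/2) *\<^sub>R (W - transpose W)) \<noteq> 0"
    and rankB: "rank B < CARD('m)"
    and mn: "CARD('m) \<le> CARD('n)"
    and b_range: "b \<in> range (\<lambda>x. saddle W B *v x)"
    and om_pos: "\<omega> > 0"
    and om_bound:
      "\<omega> < (- lambda_max ((1/2) *\<^sub>R (W + transpose W))
              + sqrt ((lambda_max ((1/2) *\<^sub>R (W + transpose W)))\<^sup>2
                      + 16 * (spec_norm (lower_part ((1/2) *\<^sub>R (W - transpose W))))\<^sup>2))
            / (4 * (spec_norm (lower_part ((1/2) *\<^sub>R (W - transpose W))))\<^sup>2)"
  shows "\<forall>x0. \<exists>x. (\<lambda>k. iterate
              (saddle ((1/\<omega>) *\<^sub>R ((mat 1 + \<omega> *\<^sub>R lower_part ((1/2) *\<^sub>R (W - transpose W)))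
                        ** (mat 1 + \<omega> *\<^sub>R upper_part ((1/2) *\<^sub>R (W - transpose W))))) B)
              (saddle W B) b x0 k) \<longlonglongrightarrow> x
           \<and> saddle W B *v x = b"
proof -
  define S where "S = (1/2) *\<^sub>R (W - transpose W)"
  define L where "L = spec_norm (lower_part S)"
  define lam where "lam = lambda_max ((1/2) *\<^sub>R (W + transpose W))"
  have S: "S = skew_part W" and lam: "lam = lambda_max (sym_part W)"
    by (simp_all add: S_def lam_def skew_part_def sym_part_def)
  have "L > 0"
    using spec_norm_pos Ls_nz unfolding L_def S_def by blast
  then have "2 * L\<^sup>2 * \<omega>\<^sup>2 + lam * \<omega> < 2"
    using quadratic_less_below_positive_root[of "2 * L\<^sup>2" 2 \<omega> lam] om_pos om_bound
    by (simp add: L_def S_def lam_def mult.assoc)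
  then have "\<exists>x. (\<lambda>k. iterate (saddle (sts_matrix \<omega> S) B) (saddle W B) b x0 k) \<longlonglongrightarrow> x
      \<and> saddle W B *v x = b" for x0
    using om_pos b_range unfolding S lam L_def
    by (intro saddle_iteration_convergent posdef sts_matrix_minus_symmetric sts_twice_minus_positive_definite)
      auto
  then show ?thesis
    by (simp add: sts_matrix_def S_def)
qed

end
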